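(* For every integer $n\ge 1$, the total number $d(n)$ of divisions of a honeycomb strip of length $n$ (into any number of pieces) equals $F_{2n-1}$, where $F_m$ is the $m$-th Fibonacci number ($F_1=F_2=1$, $F_{m+1}=F_m+F_{m-1}$).
   Context: A honeycomb strip of length $n$ consists of $n$ hexagons labelled $1,\dots,n$ in which hexagon $i$ is adjacent exactly with hexagons $i\pm1$ and $i\pm2$ (when these exist); equivalently its inner dual is the graph $P_n^2$ on vertices $1,\dots,n$ with $i\sim j$ iff $1\le|i-j|\le2$. A division is a partition of the hexagons into blocks each inducing a connected subgraph of $P_n^2$ (cuts are made only along edges of hexagons). *)

theory Defs
  imports
    "HOL-Library.Disjoint_Sets"
    "HOL-Number_Theory.Fib"
    "Graph_Theory.Digraph_Component"
begin

text \<open>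
  The inner dual \<open>P\<^sub>n\<^sup>2\<close> of the honeycomb strip of length \<open>n\<close>; an undirected edge is
  represented by the two opposite arcs.
\<close>

definition strip :: "nat \<Rightarrow> nat pair_pre_digraph" where
  "strip n = \<lparr> pverts = {1..n},
     parcs = {(i, j). i \<in> {1..n} \<and> j \<in> {1..n} \<and>
                1 \<le> \<bar>int i - int j\<bar> \<and> \<bar>int i - int j\<bar> \<le> 2} \<rparr>"

lemma graph_strip: "graph (with_proj (strip n))"
proof -
  have "parcs (strip n) \<subseteq> {1..n} \<times> {1..n}"
    by (auto simp: strip_def)
  then have "finite (parcs (strip n))"
    by (rule finite_subset) simp
  then show ?thesis
    by unfold_locales (auto simp: strip_def symmetric_def arc_to_ends_def intro!: symI)
qed

definition division :: "nat \<Rightarrow> nat set set \<Rightarrow> bool" where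
  "division n P \<longleftrightarrow>
     partition_on {1..n} P \<and> (\<forall>B\<in>P. connected (with_proj (strip n) \<restriction> B))"

definition num_divisions :: "nat \<Rightarrow> nat" where
  "num_divisions n = card {P. division n P}"

lemma finite_divisions: "finite {P. division n P}"
  by (rule finite_subset[of _ "Pow (Pow {1..n})"])
    (auto simp: division_def partition_on_def)

end

theory Submission
  imports Defs
begin

text \<open>
  A block of the strip is connected iff its consecutive elements differ by at most 2. Hence deleting
  hexagon \<open>n + 1\<close> from a division of the strip of length \<open>n + 1\<close> leaves a division of the strip of
  length \<open>n\<close>, and conversely \<open>n + 1\<close> can be added to a division as a singleton, to the block of \<open>n\<close>,
  or to the block of \<open>n - 1\<close>. The last two options coincide unless \<open>n - 1\<close> and \<open>n\<close> lie in different
  blocks. If \<open>s n\<close> counts the divisions for which they do, then \<open>d (n + 1) = 2 * d n + s n\<close> and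
  \<open>s (n + 1) = d n + s n\<close>, the recurrence satisfied by \<open>fib (2 * n - 1)\<close> and \<open>fib (2 * n - 2)\<close>.
\<close>

section \<open>Connected blocks as sets without long gaps\<close>

text \<open>\<open>y\<close> only certifies that \<open>x\<close> is not the maximum; the next
  element is then at most 2 ahead.\<close>

definition gapless :: "nat set \<Rightarrow> bool" where
  "gapless B \<longleftrightarrow> (\<forall>x\<in>B. \<forall>y\<in>B. x < y \<longrightarrow> (\<exists>z\<in>B. x < z \<and> z \<le> x + 2))"

text \<open>The arcs of the strip already come in opposite pairs, so the symmetric closure in
  \<open>connected\<close> adds none; \<open>B \<noteq> {}\<close> is part of strong
  connectivity.\<close>

lemma connected_strip_iff_rtrancl_on:
  assumes "B \<subseteq> {1..n}"
  shows "connected (with_proj (strip n) \<restriction> B) \<longleftrightarrow>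
    B \<noteq> {} \<and> (\<forall>u\<in>B. \<forall>v\<in>B. (u, v) \<in> rtrancl_on B
      {(i, j). i \<in> B \<and> j \<in> B \<and> i \<noteq> j \<and> i \<le> j + 2 \<and> j \<le> i + 2})"
proof -
  let ?G = "mk_symmetric (with_proj (strip n) \<restriction> B)"
  let ?r = "{(i, j). i \<in> B \<and> j \<in> B \<and> i \<noteq> j \<and> i \<le> j + 2 \<and> j \<le> i + 2}"
  have "arcs (with_proj (strip n) \<restriction> B) = parcs (strip n) \<inter> B \<times> B"
    by (auto simp: induce_subgraph_def)
  also have "\<dots> = ?r"
    using assms by (auto simp: strip_def)
  finally have "parcs ?G = (\<Union>e\<in>?r. {(fst e, snd e), (snd e, fst e)})"
    by (simp only: parcs_mk_symmetric) (simp add: induce_subgraph_def)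
  also have "\<dots> = ?r"
    by auto
  finally have "arcs_ends (with_proj ?G) = ?r"
    by (simp add: arcs_ends_def arc_to_ends_def)
  then show ?thesis
    by (simp add: connected_def strongly_connected_def reachable_def mk_symmetric_def
        induce_subgraph_def)
qed

text \<open>A walk advances by at most 2 per step and cannot jump over two missing hexagons in a
  row. Conversely, in a gapless set one can climb from any element to any larger one, and symmetry
  gives the way back.\<close>

lemma connected_strip_iff_gapless:
  assumes "B \<subseteq> {1..n}"
  shows "connected (with_proj (strip n) \<restriction> B) \<longleftrightarrow> B \<noteq> {} \<and> gapless B"
proof -
  let ?r = "{(i, j). i \<in> B \<and> j \<in> B \<and> i \<noteq> j \<and> i \<le> j + 2 \<and> j \<le> i + 2}"
  have "gapless B" if conn: "\<forall>u\<in>B. \<forall>v\<in>B. (u, v) \<in> rtrancl_on B ?r"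
    unfolding gapless_def
  proof (intro ballI impI, rule ccontr)
    fix x y assume xy: "x \<in> B" "y \<in> B" "x < y" and gap: "\<not> (\<exists>z\<in>B. x < z \<and> z \<le> x + 2)"
    have "(x, y) \<in> rtrancl_on B ?r" using conn xy by blast
    \<comment> \<open>The invariant is that the walk never rises above \<open>x\<close>: a step from
      \<open>u \<le> x\<close> ends at most at \<open>x + 2\<close>, where \<open>gap\<close> leaves
      no element above \<open>x\<close>.\<close>
    then have "y \<le> x"
    proof (induction rule: rtrancl_on_induct)
      case (step u v)
      then have "v \<le> x + 2" "v \<in> B" by auto
      then show ?case using gap not_less by blast
    qed simp
    with xy show False by simp
  qed
  moreover have "(u, v) \<in> rtrancl_on B ?r" if gl: "gapless B" and uv: "u \<in> B" "v \<in> B" for u v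
  proof -
    have up: "(x, y) \<in> rtrancl_on B ?r" if "x \<in> B" "y \<in> B" "x \<le> y" for x y
      using that
    proof (induction "y - x" arbitrary: x rule: less_induct)
      case less
      show ?case
      proof (cases "y \<le> x + 2")
        case True
        with less.prems show ?thesis
          by (cases "x = y")
            (auto intro!: rtrancl_on_into_rtrancl_on[OF rtrancl_on_refl])
      next
        case False
        with gl less.prems obtain z where z: "z \<in> B" "x < z" "z \<le> x + 2"
          unfolding gapless_def by (meson le_add1 le_trans not_less)
        then have "(z, y) \<in> rtrancl_on B ?r"
          using False less.prems by (intro less.hyps) auto
        with z less.prems show ?thesis
          by (auto intro!: converse_rtrancl_on_into_rtrancl_on[of x z])
      qed
    qed
    have "sym (rtrancl_on B ?r)"
      by (intro rtrancl_on_sym) (auto simp: sym_def)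
    then show ?thesis
      using up uv by (meson nat_le_linear symD)
  qed
  ultimately show ?thesis
    unfolding connected_strip_iff_rtrancl_on[OF assms] by blast
qed

lemma division_iff_gapless:
  "division n P \<longleftrightarrow> partition_on {1..n} P \<and> (\<forall>B\<in>P. gapless B)"
proof -
  have "connected (with_proj (strip n) \<restriction> B) \<longleftrightarrow> gapless B"
    if "partition_on {1..n} P" "B \<in> P" for B
    using that connected_strip_iff_gapless[of B n] unfolding partition_on_def by blast
  then show ?thesis unfolding division_def by blast
qed

lemma gapless_empty [simp]: "gapless {}"
  by (simp add: gapless_def)

text \<open>The new element exceeds all of \<open>C\<close>, so the only new condition is that
  \<open>Max C\<close> is within 2 of \<open>Suc n\<close>. For \<open>n = 1\<close> the alternative
  \<open>n - 1\<close> is 0, which is not in \<open>C\<close>.\<close>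

lemma gapless_insert_Suc:
  assumes "C \<subseteq> {1..n}"
  shows "gapless (insert (Suc n) C) \<longleftrightarrow> gapless C \<and> (C = {} \<or> n \<in> C \<or> n - 1 \<in> C)"
proof (intro iffI conjI)
  assume g: "gapless (insert (Suc n) C)"
  show "gapless C"
    unfolding gapless_def
  proof (intro ballI impI)
    fix x y assume xy: "x \<in> C" "y \<in> C" "x < y"
    with g obtain z where z: "z \<in> insert (Suc n) C" "x < z" "z \<le> x + 2"
      unfolding gapless_def by blast
    show "\<exists>z\<in>C. x < z \<and> z \<le> x + 2"
    proof (cases "z = Suc n")
      case True
      \<comment> \<open>The witness is the new element, so \<open>y < z\<close> is itself close
        enough to \<open>x\<close>.\<close>
      then have "y \<le> x + 2" using xy z assms by auto
      with xy show ?thesis by blast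
    qed (use z in blast)
  qed
  show "C = {} \<or> n \<in> C \<or> n - 1 \<in> C"
  proof (cases "C = {}")
    case False
    have fin: "finite C" using assms finite_subset by blast
    let ?m = "Max C"
    have m: "?m \<in> C" using fin False by simp
    then have "?m < Suc n" using assms by auto
    with g m obtain z where z: "z \<in> insert (Suc n) C" "?m < z" "z \<le> ?m + 2"
      unfolding gapless_def by blast
    then have "z = Suc n" using fin Max_ge not_less by blast
    with z \<open>?m < Suc n\<close> have "?m = n \<or> ?m = n - 1" by linarith
    with m show ?thesis by metis
  qed simp
next
  assume g: "gapless C \<and> (C = {} \<or> n \<in> C \<or> n - 1 \<in> C)"
  show "gapless (insert (Suc n) C)"
    unfolding gapless_def
  proof (intro ballI impI)
    fix x y assume xy: "x \<in> insert (Suc n) C" "y \<in> insert (Suc n) C" "x < y"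
    then have x: "x \<in> C" "x \<le> n" using assms by auto
    show "\<exists>z\<in>insert (Suc n) C. x < z \<and> z \<le> x + 2"
    proof (cases "Suc n \<le> x + 2")
      case True
      with x show ?thesis by (intro bexI[of _ "Suc n"]) auto
    next
      case False
      \<comment> \<open>Here \<open>x < n - 1\<close>, so whichever of \<open>n\<close> and
        \<open>n - 1\<close> lies in \<open>C\<close> serves as \<open>w\<close>.\<close>
      with g x obtain w where "w \<in> C" "x < w" by fastforce
      with g x show ?thesis unfolding gapless_def by blast
    qed
  qed
qed

section \<open>Adding one point to a set partition\<close>

text \<open>\<open>C = {}\<close> encodes the choice of a new singleton block: a partition lacks
  \<open>{}\<close>, so subtracting \<open>{C}\<close> then removes nothing.\<close>

definition add_to_block :: "'a \<Rightarrow> 'a set set \<Rightarrow> 'a set \<Rightarrow> 'a set set" where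
  "add_to_block x P C = insert (insert x C) (P - {C})"

lemma partition_on_add_to_block:
  assumes "partition_on A P" "x \<notin> A" "C \<in> insert {} P"
  shows "partition_on (insert x A) (add_to_block x P C)"
proof (rule partition_onI)
  show "\<Union> (add_to_block x P C) = insert x A"
    using assms unfolding partition_on_def add_to_block_def by blast
  fix p q assume "p \<in> add_to_block x P C" "q \<in> add_to_block x P C" "p \<noteq> q"
  moreover have "x \<notin> B" if "B \<in> P" for B
    using assms that unfolding partition_on_def by blast
  moreover have "B \<inter> B' = {}" if "B \<in> insert {} P" "B' \<in> insert {} P" "B \<noteq> B'" for B B'
    using assms that unfolding partition_on_def disjoint_def by blast
  ultimately show "disjnt p q"
    using assms(3) unfolding add_to_block_def disjnt_def by auto
next
  show "{} \<notin> add_to_block x P C"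
    using assms unfolding partition_on_def add_to_block_def by blast
qed

text \<open>Both arguments can be read off the result: \<open>C\<close> is the block containing
  \<open>x\<close> without \<open>x\<close>, and \<open>P\<close> arises by putting \<open>C\<close>
  back in its place and discarding \<open>{}\<close>.\<close>

lemma inj_on_add_to_block:
  assumes "x \<notin> A"
  shows "inj_on (\<lambda>(P, C). add_to_block x P C) (SIGMA P:{P. partition_on A P}. insert {} P)"
proof -
  have block: "{B \<in> add_to_block x P C. x \<in> B} = {insert x C}"
    and rest: "insert C (add_to_block x P C - {insert x C}) - {{}} = P"
    and new: "insert x C - {x} = C"
    if "partition_on A P" "C \<in> insert {} P" for P C
  proof -
    have x: "x \<notin> B" if "B \<in> insert {} P" for B
      using \<open>partition_on A P\<close> that assms unfolding partition_on_def by blast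
    then show "{B \<in> add_to_block x P C. x \<in> B} = {insert x C}"
      unfolding add_to_block_def by blast
    show "insert x C - {x} = C"
      using x that by blast
    have "{} \<notin> P" "insert x C \<notin> P"
      using that x unfolding partition_on_def by blast+
    then show "insert C (add_to_block x P C - {insert x C}) - {{}} = P"
      using that unfolding add_to_block_def by blast
  qed
  have "P = P' \<and> C = C'"
    if P: "partition_on A P" "C \<in> insert {} P" and P': "partition_on A P'" "C' \<in> insert {} P'"
      and eq: "add_to_block x P C = add_to_block x P' C'" for P C P' C'
  proof -
    have ins: "insert x C = insert x C'"
      using trans[OF sym[OF block[OF P, unfolded eq]] block[OF P']] by (rule singleton_inject)
    have "C = C'"
      using new[OF P] new[OF P'] unfolding ins by (rule trans[OF sym])
    moreover have "P = P'"
      using rest[OF P] rest[OF P'] unfolding eq unfolding ins \<open>C = C'\<close> by (rule trans[OF sym])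
    ultimately show ?thesis by blast
  qed
  then show ?thesis
    unfolding inj_on_def Ball_def split_paired_All mem_Sigma_iff mem_Collect_eq prod.case prod.inject by blast
qed

text \<open>Deleting \<open>x\<close> from every block and dropping \<open>{}\<close> gives
  \<open>P\<close>; what remains of the block of \<open>x\<close>, possibly nothing, is
  \<open>C\<close>.\<close>

lemma add_to_block_surj:
  assumes "partition_on (insert x A) Q" "x \<notin> A"
  obtains P C where "partition_on A P" "C \<in> insert {} P" "Q = add_to_block x P C"
proof -
  from assms obtain B where B: "B \<in> Q" "x \<in> B"
    unfolding partition_on_def by blast
  have disj: "B' \<inter> B'' = {}" if "B' \<in> Q" "B'' \<in> Q" "B' \<noteq> B''" for B' B''
    using assms that unfolding partition_on_def disjoint_def by blast
  have un: "\<Union> Q = insert x A" and ne: "{} \<notin> Q"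
    using assms unfolding partition_on_def by auto
  let ?C = "B - {x}"
  let ?P = "(\<lambda>B'. B' - {x}) ` Q - {{}}"
  have x: "B' - {x} = B'" if "B' \<in> Q - {B}" for B'
    using disj[of B' B] B that by blast
  have "partition_on A ?P"
  proof (rule partition_onI)
    have "\<Union> ?P = \<Union> Q - {x}" by auto
    then show "\<Union> ?P = A" using un assms(2) by simp
    show "disjnt p q" if pq: "p \<in> ?P" "q \<in> ?P" "p \<noteq> q" for p q
    proof -
      from pq obtain p' q' where p'q': "p' \<in> Q" "q' \<in> Q" "p = p' - {x}" "q = q' - {x}"
        by blast
      with pq(3) disj[of p' q'] have "p' \<inter> q' = {}" by blast
      with p'q' show ?thesis unfolding disjnt_def by blast
    qed
  qed simp
  moreover have "Q = add_to_block x ?P ?C"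
  proof -
    \<comment> \<open>If \<open>?C\<close> were also another block of \<open>Q\<close>, that block
      would be lost together with the trace of \<open>B\<close>.\<close>
    have "?C \<notin> Q - {B}"
    proof
      assume C: "?C \<in> Q - {B}"
      with disj[of ?C B] B have "?C \<inter> B = {}" by blast
      then have "?C = {}" by blast
      with C ne show False by simp
    qed
    moreover have "(\<lambda>B'. B' - {x}) ` Q = insert ?C (Q - {B})"
    proof -
      have "(\<lambda>B'. B' - {x}) ` (Q - {B}) = (\<lambda>B'. B') ` (Q - {B})"
        using x by (intro image_cong) auto
      then show ?thesis using B(1) by (metis image_ident image_insert insert_Diff)
    qed
    ultimately have "?P - {?C} = Q - {B}" using ne by auto
    then show ?thesis
      using B unfolding add_to_block_def by (simp add: insert_absorb)
  qed
  moreover have "?C \<in> insert {} ?P" using B(1) by blast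
  ultimately show ?thesis using that by blast
qed

section \<open>Extending a division by one hexagon\<close>

definition extendable_blocks :: "nat \<Rightarrow> nat set set \<Rightarrow> nat set set" where
  "extendable_blocks n P = {C \<in> insert {} P. C = {} \<or> n \<in> C \<or> n - 1 \<in> C}"

text \<open>Only the block \<open>C\<close> changes, so gaplessness of the other blocks carries over
  and \<open>gapless_insert_Suc\<close> decides the enlarged one.\<close>

lemma division_add_to_block_iff:
  assumes "partition_on {1..n} P" "C \<in> insert {} P"
  shows "division (Suc n) (add_to_block (Suc n) P C) \<longleftrightarrow>
    division n P \<and> C \<in> extendable_blocks n P"
proof -
  have "partition_on {1..Suc n} (add_to_block (Suc n) P C)"
    using partition_on_add_to_block[OF assms(1) _ assms(2), of "Suc n"]
    by (simp add: atLeastAtMostSuc_conv)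
  moreover have "C \<subseteq> {1..n}"
    using assms unfolding partition_on_def by blast
  ultimately show ?thesis
    using assms
    by (auto simp: division_iff_gapless add_to_block_def extendable_blocks_def gapless_insert_Suc)
qed

text \<open>The correspondence for arbitrary partitions is restricted to the pairs that yield
  divisions.\<close>

lemma divisions_Suc:
  "bij_betw (\<lambda>(P, C). add_to_block (Suc n) P C)
    (SIGMA P:{P. division n P}. extendable_blocks n P) {Q. division (Suc n) Q}"
proof -
  let ?S = "SIGMA P:{P. division n P}. extendable_blocks n P"
  have sub: "?S \<subseteq> (SIGMA P:{P. partition_on {1..n} P}. insert {} P)"
    by (auto simp: division_def extendable_blocks_def)
  then have "inj_on (\<lambda>(P, C). add_to_block (Suc n) P C) ?S"
    using inj_on_add_to_block[of "Suc n" "{1..n}"] inj_on_subset by fastforce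
  moreover have "(\<lambda>(P, C). add_to_block (Suc n) P C) ` ?S = {Q. division (Suc n) Q}"
  proof (intro equalityI subsetI)
    fix Q assume "Q \<in> (\<lambda>(P, C). add_to_block (Suc n) P C) ` ?S"
    then obtain P C where PC: "(P, C) \<in> ?S" "Q = add_to_block (Suc n) P C" by blast
    with sub have "partition_on {1..n} P" "C \<in> insert {} P" by blast+
    with PC show "Q \<in> {Q. division (Suc n) Q}"
      using division_add_to_block_iff[of n P C] by blast
  next
    fix Q assume Q: "Q \<in> {Q. division (Suc n) Q}"
    then have "partition_on (insert (Suc n) {1..n}) Q"
      by (simp add: division_def atLeastAtMostSuc_conv)
    then obtain P C where PC: "partition_on {1..n} P" "C \<in> insert {} P" "Q = add_to_block (Suc n) P C"
      by (rule add_to_block_surj) auto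
    with Q have "(P, C) \<in> ?S"
      using division_add_to_block_iff[of n P C] by blast
    with PC show "Q \<in> (\<lambda>(P, C). add_to_block (Suc n) P C) ` ?S" by force
  qed
  ultimately show ?thesis unfolding bij_betw_def by blast
qed

section \<open>Counting extensions and the Fibonacci recurrence\<close>

text \<open>For \<open>n = 1\<close> this is false, since no block contains \<open>0\<close>.\<close>

definition splits_end :: "nat \<Rightarrow> nat set set \<Rightarrow> bool" where
  "splits_end n P \<longleftrightarrow> (\<exists>B\<in>P. n \<notin> B \<and> n - 1 \<in> B)"

text \<open>\<open>{}\<close> and the block of \<open>n\<close> always qualify; the block of
  \<open>n - 1\<close> is a further choice exactly when it exists and avoids
  \<open>n\<close>.\<close>

lemma card_extendable_blocks:
  assumes "division n P" "n \<ge> 1"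
  shows "finite (extendable_blocks n P)"
    and "card {C \<in> extendable_blocks n P. n \<notin> C} = (if splits_end n P then 2 else 1)"
    and "card (extendable_blocks n P) = (if splits_end n P then 3 else 2)"
proof -
  have disj: "B = B'" if "B \<in> P" "B' \<in> P" "a \<in> B" "a \<in> B'" for B B' a
    using assms that unfolding division_def partition_on_def disjoint_def by blast
  have ne: "{} \<notin> P" and "n \<in> \<Union>P"
    using assms unfolding division_def partition_on_def by auto
  then obtain N where N: "N \<in> P" "n \<in> N" by blast
  have split: "extendable_blocks n P = insert N {C \<in> extendable_blocks n P. n \<notin> C}"
    using N disj unfolding extendable_blocks_def by blast
  have "finite {C \<in> extendable_blocks n P. n \<notin> C} \<and>
    card {C \<in> extendable_blocks n P. n \<notin> C} = (if splits_end n P then 2 else 1)"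
  proof (cases "splits_end n P")
    case True
    then obtain M where M: "M \<in> P" "n \<notin> M" "n - 1 \<in> M"
      unfolding splits_end_def by blast
    then have "{C \<in> extendable_blocks n P. n \<notin> C} = {{}, M}"
      using disj unfolding extendable_blocks_def by blast
    moreover have "M \<noteq> {}" using M by blast
    ultimately show ?thesis using True by simp
  next
    case False
    then have "{C \<in> extendable_blocks n P. n \<notin> C} = {{}}"
      unfolding extendable_blocks_def splits_end_def by blast
    then show ?thesis using False by simp
  qed
  then have fin: "finite {C \<in> extendable_blocks n P. n \<notin> C}"
    and card: "card {C \<in> extendable_blocks n P. n \<notin> C} = (if splits_end n P then 2 else 1)"
    by auto
  show "card {C \<in> extendable_blocks n P. n \<notin> C} = (if splits_end n P then 2 else 1)" by fact
  show "finite (extendable_blocks n P)" using fin split by (metis finite_insert)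
  have "card (extendable_blocks n P) = Suc (card {C \<in> extendable_blocks n P. n \<notin> C})"
    using N fin by (subst split, subst card_insert_disjoint) auto
  with card show "card (extendable_blocks n P) = (if splits_end n P then 3 else 2)" by simp
qed

text \<open>Applied with \<open>a = 2\<close> to all extendable blocks and with \<open>a = 1\<close>
  to those that avoid \<open>n\<close>.\<close>

lemma sum_splits_end:
  fixes a :: nat
  shows "(\<Sum>P | division n P. if splits_end n P then Suc a else a) =
    a * num_divisions n + card {P. division n P \<and> splits_end n P}"
proof -
  have "(\<Sum>P | division n P. if splits_end n P then Suc a else a) =
    (\<Sum>P | division n P. a + (if splits_end n P then 1 else 0))"
    by (rule sum.cong) auto
  also have "\<dots> = a * num_divisions n + (\<Sum>P | division n P. if splits_end n P then 1 else 0)"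
    by (simp add: sum.distrib num_divisions_def)
  also have "(\<Sum>P | division n P. if splits_end n P then 1 else 0) =
    card {P. division n P \<and> splits_end n P}"
    using finite_divisions[of n] by (simp add: sum.If_cases Int_def)
  finally show ?thesis .
qed

lemma num_divisions_Suc:
  assumes "n \<ge> 1"
  shows "num_divisions (Suc n) = 2 * num_divisions n + card {P. division n P \<and> splits_end n P}"
proof -
  have "num_divisions (Suc n) = card (SIGMA P:{P. division n P}. extendable_blocks n P)"
    using divisions_Suc unfolding num_divisions_def by (rule bij_betw_same_card[symmetric])
  also have "\<dots> = (\<Sum>P | division n P. card (extendable_blocks n P))"
    using assms card_extendable_blocks(1) finite_divisions by (intro card_SigmaI) auto
  also have "\<dots> = (\<Sum>P | division n P. if splits_end n P then Suc 2 else 2)"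
    using assms card_extendable_blocks(3) by (intro sum.cong) auto
  finally show ?thesis unfolding sum_splits_end .
qed

text \<open>\<open>n\<close> and \<open>Suc n\<close> are separated exactly when
  \<open>Suc n\<close> did not join the block of \<open>n\<close>, so only the choices
  \<open>C\<close> that avoid \<open>n\<close> are counted.\<close>

lemma card_splits_end_Suc:
  assumes "n \<ge> 1"
  shows "card {P. division (Suc n) P \<and> splits_end (Suc n) P} =
    num_divisions n + card {P. division n P \<and> splits_end n P}"
proof -
  let ?f = "\<lambda>(P, C). add_to_block (Suc n) P C"
  let ?S = "SIGMA P:{P. division n P}. extendable_blocks n P"
  let ?T = "SIGMA P:{P. division n P}. {C \<in> extendable_blocks n P. n \<notin> C}"
  have iff: "splits_end (Suc n) (add_to_block (Suc n) P C) \<longleftrightarrow> n \<notin> C"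
    if "division n P" "C \<in> extendable_blocks n P" for P C
  proof -
    have un: "\<Union>P = {1..n}"
      using that unfolding division_def partition_on_def by blast
    have disj: "B = B'" if "B \<in> P" "B' \<in> P" "n \<in> B" "n \<in> B'" for B B'
      using \<open>division n P\<close> that unfolding division_def partition_on_def disjoint_def by blast
    have "n \<in> \<Union>P" using un assms by simp
    then obtain N where N: "N \<in> P" "n \<in> N" by blast
    then have "N \<subseteq> {1..n}" using un by blast
    then have Suc_n: "Suc n \<notin> N" by auto
    show ?thesis
    proof
      assume "splits_end (Suc n) (add_to_block (Suc n) P C)"
      \<comment> \<open>A block with \<open>n\<close> but without \<open>Suc n\<close> is not the
        enlarged one, so it is an old block different from \<open>C\<close>.\<close>
      then obtain B where "B \<in> P" "B \<noteq> C" "n \<in> B"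
        unfolding splits_end_def add_to_block_def by auto
      with disj that(2) show "n \<notin> C"
        unfolding extendable_blocks_def by blast
    next
      assume "n \<notin> C"
      with N have "N \<in> add_to_block (Suc n) P C"
        unfolding add_to_block_def by blast
      with N Suc_n show "splits_end (Suc n) (add_to_block (Suc n) P C)"
        unfolding splits_end_def by auto
    qed
  qed
  have bij: "bij_betw ?f ?S {Q. division (Suc n) Q}"
    by (rule divisions_Suc)
  have "?f ` ?T = {P. division (Suc n) P \<and> splits_end (Suc n) P}"
  proof (intro equalityI subsetI)
    fix Q assume "Q \<in> ?f ` ?T"
    then obtain P C where PC: "(P, C) \<in> ?T" "Q = ?f (P, C)" by blast
    then have "Q \<in> {Q. division (Suc n) Q}"
      using bij_betw_apply[OF bij, of "(P, C)"] by auto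
    with PC show "Q \<in> {P. division (Suc n) P \<and> splits_end (Suc n) P}"
      using iff by auto
  next
    fix Q assume Q: "Q \<in> {P. division (Suc n) P \<and> splits_end (Suc n) P}"
    then have "Q \<in> ?f ` ?S" using bij unfolding bij_betw_def by simp
    with Q iff show "Q \<in> ?f ` ?T" by auto
  qed
  moreover have "inj_on ?f ?T"
    using bij unfolding bij_betw_def by (auto intro: inj_on_subset)
  ultimately have "card {P. division (Suc n) P \<and> splits_end (Suc n) P} = card ?T"
    using card_image[of ?f ?T] by argo
  also have "\<dots> = (\<Sum>P | division n P. card {C \<in> extendable_blocks n P. n \<notin> C})"
    using assms card_extendable_blocks(1) finite_divisions by (intro card_SigmaI) auto
  also have "\<dots> = (\<Sum>P | division n P. if splits_end n P then Suc 1 else 1)"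
    using assms card_extendable_blocks(2) by (intro sum.cong) auto
  finally show ?thesis unfolding sum_splits_end by simp
qed

lemma division_1_iff: "division 1 P \<longleftrightarrow> P = {{1}}"
proof
  assume "division 1 P"
  then have "\<Union>P = {1}" "{} \<notin> P"
    unfolding division_def partition_on_def by auto
  moreover have "B = {1}" if "B \<in> P" for B
    using that calculation by (metis Union_upper subset_singletonD)
  ultimately show "P = {{1}}" by blast
next
  assume "P = {{1}}"
  then show "division 1 P"
    by (simp add: division_iff_gapless partition_on_def gapless_def)
qed

text \<open>Both counts are carried through the induction because each recurrence involves both; the
  index shift avoids truncated subtraction.\<close>

lemma divisions_fib:
  "num_divisions (Suc n) = fib (2 * n + 1) \<and>
   card {P. division (Suc n) P \<and> splits_end (Suc n) P} = fib (2 * n)"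
proof (induction n)
  case 0
  have "{P. division (Suc 0) P} = {{{1}}}"
    "{P. division (Suc 0) P \<and> splits_end (Suc 0) P} = {}"
    using division_1_iff by (auto simp: splits_end_def)
  then show ?case by (simp add: num_divisions_def)
next
  case (Suc n)
  then show ?case
    using num_divisions_Suc[of "Suc n"] card_splits_end_Suc[of "Suc n"] by simp
qed

theorem theorem8:
  fixes n :: nat
  assumes "n \<ge> 1"
  shows "num_divisions n = fib (2 * n - 1)"
  using assms divisions_fib[of "n - 1"] by (cases n) auto

end
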